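(* Let $\to$ be the quantifier-elimination rewrite relation on formulas defined in the context. Then the reverse relation $\leftarrow$ (where $G \leftarrow F$ iff $F \to G$) is well-founded. That is, every non-empty class $B$ of formulas contains an element $a$ such that there is no $a' \in B$ with $a \to a'$. In particular, $\to$ is terminating: there is no infinite sequence $(F_i)_{i\in\mathbb N}$ with $F_i \to F_{i+1}$ for all $i$.
   Context: Terms and formulas are those of first-order logic extended by Hilbert's $\varepsilon$-binder. The syntax has: - individual variables; - $n$-ary formula variables $A$ (free second-order variables, never bound), giving atomic formulas $A(t_1,\dots,t_n)$; - $n$-ary function and predicate symbols; - the connectives $\neg,\vee,\wedge,\Rightarrow,\dots$; - for an individual variable $x$ and a formula $F$: the term $\varepsilon x.\,F$ and the formulas $\exists x.\,F$ and $\forall x.\,F$, each binding $x$. Formulas and terms are identified modulo renaming of bound variables. Substitution $F\{x\mapsto t\}$ replaces the free occurrences of $x$ by $t$ and is capture-avoiding. For $Q\in\{\exists,\forall\}$, write $\neg^{\forall}$ for $\neg$ and $\neg^{\exists}$ for the empty string. The rewrite relation $\to$ on formulas is defined as follows: $F_1\to F_2$ iff $F_2$ is obtained from $F_1$ by replacing one occurrence of a subformula $Q x.\,A$ (with $Q\in\{\exists,\forall\}$) by $A\{x\mapsto \varepsilon x.\,\neg^{Q}A\}$. The occurrence may lie anywhere, including inside $\varepsilon$-terms and under binders. *)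

theory Defs
  imports Main
begin

text \<open>
  Expressions are taken modulo renaming of bound variables by using de Bruijn indices.  An index
  that exceeds the number of enclosing binders denotes a free individual variable, so every
  expression is meaningful and there are infinitely many free individual variables.

  The type parameters are the names of function symbols, predicate symbols, formula variables, and
  of connectives other than negation, disjunction, conjunction and implication (such as
  equivalence or the truth constants).
\<close>

datatype quantifier = Exists | Forall

datatype ('f, 'p, 'a, 'c) tm =
    Var nat
  | Fun 'f "('f, 'p, 'a, 'c) tm list"
  | Eps "('f, 'p, 'a, 'c) fm"
and ('f, 'p, 'a, 'c) fm =
    FVar 'a "('f, 'p, 'a, 'c) tm list"
  | Pred 'p "('f, 'p, 'a, 'c) tm list"
  | Neg "('f, 'p, 'a, 'c) fm"
  | Or "('f, 'p, 'a, 'c) fm" "('f, 'p, 'a, 'c) fm"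
  | And "('f, 'p, 'a, 'c) fm" "('f, 'p, 'a, 'c) fm"
  | Imp "('f, 'p, 'a, 'c) fm" "('f, 'p, 'a, 'c) fm"
  | Conn 'c "('f, 'p, 'a, 'c) fm list"
  | Quant quantifier "('f, 'p, 'a, 'c) fm"

text \<open>
  Each field gives, for every \<open>n\<close>, the set of symbols of arity \<open>n\<close>.  A name that occurs at two
  arities stands for two different symbols.
\<close>

record ('f, 'p, 'a, 'c) signature =
  fun_syms :: "nat \<Rightarrow> 'f set"
  pred_syms :: "nat \<Rightarrow> 'p set"
  fvar_syms :: "nat \<Rightarrow> 'a set"
  conn_syms :: "nat \<Rightarrow> 'c set"

primrec well_formed_tm :: "('f, 'p, 'a, 'c) signature \<Rightarrow> ('f, 'p, 'a, 'c) tm \<Rightarrow> bool"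
  and well_formed_fm :: "('f, 'p, 'a, 'c) signature \<Rightarrow> ('f, 'p, 'a, 'c) fm \<Rightarrow> bool"
where
  "well_formed_tm S (Var i) \<longleftrightarrow> True"
| "well_formed_tm S (Fun f ts) \<longleftrightarrow>
     f \<in> fun_syms S (length ts) \<and> list_all (well_formed_tm S) ts"
| "well_formed_tm S (Eps A) \<longleftrightarrow> well_formed_fm S A"
| "well_formed_fm S (FVar a ts) \<longleftrightarrow>
     a \<in> fvar_syms S (length ts) \<and> list_all (well_formed_tm S) ts"
| "well_formed_fm S (Pred p ts) \<longleftrightarrow>
     p \<in> pred_syms S (length ts) \<and> list_all (well_formed_tm S) ts"
| "well_formed_fm S (Neg A) \<longleftrightarrow> well_formed_fm S A"
| "well_formed_fm S (Or A B) \<longleftrightarrow> well_formed_fm S A \<and> well_formed_fm S B"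
| "well_formed_fm S (And A B) \<longleftrightarrow> well_formed_fm S A \<and> well_formed_fm S B"
| "well_formed_fm S (Imp A B) \<longleftrightarrow> well_formed_fm S A \<and> well_formed_fm S B"
| "well_formed_fm S (Conn c As) \<longleftrightarrow>
     c \<in> conn_syms S (length As) \<and> list_all (well_formed_fm S) As"
| "well_formed_fm S (Quant Q A) \<longleftrightarrow> well_formed_fm S A"

definition formulas :: "('f, 'p, 'a, 'c) signature \<Rightarrow> ('f, 'p, 'a, 'c) fm set" where
  "formulas S = {A. well_formed_fm S A}"

text \<open>\<open>lift_tm k\<close> and \<open>lift_fm k\<close> increment all indices from \<open>k\<close> upwards.\<close>

primrec lift_tm :: "nat \<Rightarrow> ('f, 'p, 'a, 'c) tm \<Rightarrow> ('f, 'p, 'a, 'c) tm"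
  and lift_fm :: "nat \<Rightarrow> ('f, 'p, 'a, 'c) fm \<Rightarrow> ('f, 'p, 'a, 'c) fm"
where
  "lift_tm k (Var i) = Var (if i < k then i else Suc i)"
| "lift_tm k (Fun f ts) = Fun f (map (lift_tm k) ts)"
| "lift_tm k (Eps A) = Eps (lift_fm (Suc k) A)"
| "lift_fm k (FVar a ts) = FVar a (map (lift_tm k) ts)"
| "lift_fm k (Pred p ts) = Pred p (map (lift_tm k) ts)"
| "lift_fm k (Neg A) = Neg (lift_fm k A)"
| "lift_fm k (Or A B) = Or (lift_fm k A) (lift_fm k B)"
| "lift_fm k (And A B) = And (lift_fm k A) (lift_fm k B)"
| "lift_fm k (Imp A B) = Imp (lift_fm k A) (lift_fm k B)"
| "lift_fm k (Conn c As) = Conn c (map (lift_fm k) As)"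
| "lift_fm k (Quant Q A) = Quant Q (lift_fm (Suc k) A)"

text \<open>
  \<open>subst_fm k s A\<close> replaces index \<open>k\<close> by \<open>s\<close> and decrements the larger indices, since the binder
  of \<open>k\<close> disappears.  Lifting \<open>s\<close> under each binder makes the substitution capture-avoiding.
\<close>

primrec subst_tm ::
    "nat \<Rightarrow> ('f, 'p, 'a, 'c) tm \<Rightarrow> ('f, 'p, 'a, 'c) tm \<Rightarrow> ('f, 'p, 'a, 'c) tm"
  and subst_fm ::
    "nat \<Rightarrow> ('f, 'p, 'a, 'c) tm \<Rightarrow> ('f, 'p, 'a, 'c) fm \<Rightarrow> ('f, 'p, 'a, 'c) fm"
where
  "subst_tm k s (Var i) = (if i < k then Var i else if i = k then s else Var (i - 1))"
| "subst_tm k s (Fun f ts) = Fun f (map (subst_tm k s) ts)"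
| "subst_tm k s (Eps A) = Eps (subst_fm (Suc k) (lift_tm 0 s) A)"
| "subst_fm k s (FVar a ts) = FVar a (map (subst_tm k s) ts)"
| "subst_fm k s (Pred p ts) = Pred p (map (subst_tm k s) ts)"
| "subst_fm k s (Neg A) = Neg (subst_fm k s A)"
| "subst_fm k s (Or A B) = Or (subst_fm k s A) (subst_fm k s B)"
| "subst_fm k s (And A B) = And (subst_fm k s A) (subst_fm k s B)"
| "subst_fm k s (Imp A B) = Imp (subst_fm k s A) (subst_fm k s B)"
| "subst_fm k s (Conn c As) = Conn c (map (subst_fm k s) As)"
| "subst_fm k s (Quant Q A) = Quant Q (subst_fm (Suc k) (lift_tm 0 s) A)"

primrec neg_if_Forall :: "quantifier \<Rightarrow> ('f, 'p, 'a, 'c) fm \<Rightarrow> ('f, 'p, 'a, 'c) fm" where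
  "neg_if_Forall Exists A = A"
| "neg_if_Forall Forall A = Neg A"

text \<open>
  Replacement of one occurrence of a quantified subformula, in a term and in a formula.  Since
  epsilon-terms contain formulas, the occurrence may lie inside a term.
\<close>

inductive qelim_tm :: "('f, 'p, 'a, 'c) tm \<Rightarrow> ('f, 'p, 'a, 'c) tm \<Rightarrow> bool"
  and qelim :: "('f, 'p, 'a, 'c) fm \<Rightarrow> ('f, 'p, 'a, 'c) fm \<Rightarrow> bool"  (infix "\<rightarrow>\<^sub>Q" 50)
where
  redex: "Quant Q A \<rightarrow>\<^sub>Q subst_fm 0 (Eps (neg_if_Forall Q A)) A"
| Fun: "qelim_tm t t' \<Longrightarrow> qelim_tm (Fun f (ss @ t # us)) (Fun f (ss @ t' # us))"
| Eps: "A \<rightarrow>\<^sub>Q A' \<Longrightarrow> qelim_tm (Eps A) (Eps A')"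
| FVar: "qelim_tm t t' \<Longrightarrow> FVar a (ss @ t # us) \<rightarrow>\<^sub>Q FVar a (ss @ t' # us)"
| Pred: "qelim_tm t t' \<Longrightarrow> Pred p (ss @ t # us) \<rightarrow>\<^sub>Q Pred p (ss @ t' # us)"
| Neg: "A \<rightarrow>\<^sub>Q A' \<Longrightarrow> Neg A \<rightarrow>\<^sub>Q Neg A'"
| Or_left: "A \<rightarrow>\<^sub>Q A' \<Longrightarrow> Or A B \<rightarrow>\<^sub>Q Or A' B"
| Or_right: "B \<rightarrow>\<^sub>Q B' \<Longrightarrow> Or A B \<rightarrow>\<^sub>Q Or A B'"
| And_left: "A \<rightarrow>\<^sub>Q A' \<Longrightarrow> And A B \<rightarrow>\<^sub>Q And A' B"
| And_right: "B \<rightarrow>\<^sub>Q B' \<Longrightarrow> And A B \<rightarrow>\<^sub>Q And A B'"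
| Imp_left: "A \<rightarrow>\<^sub>Q A' \<Longrightarrow> Imp A B \<rightarrow>\<^sub>Q Imp A' B"
| Imp_right: "B \<rightarrow>\<^sub>Q B' \<Longrightarrow> Imp A B \<rightarrow>\<^sub>Q Imp A B'"
| Conn: "A \<rightarrow>\<^sub>Q A' \<Longrightarrow> Conn c (As @ A # Bs) \<rightarrow>\<^sub>Q Conn c (As @ A' # Bs)"
| Quant: "A \<rightarrow>\<^sub>Q A' \<Longrightarrow> Quant Q A \<rightarrow>\<^sub>Q Quant Q A'"

end

theory Submission
  imports Defs
begin

text \<open>
  Interpret a formula as a monotone function of a natural number assigned to each free variable:
  sum up over the immediate subexpressions, give an epsilon-bound variable the value 0, and set
  \<open>[Q x. A] = 1 + [A](x := [\<epsilon> x. A])\<close>.  Since substitution is composition, the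
  contractum of a quantifier has exactly one less than its redex, and the interpretation is
  strictly monotone in every subformula.  So every rewrite step decreases it.
\<close>

primrec weight_tm :: "('f, 'p, 'a, 'c) tm \<Rightarrow> (nat \<Rightarrow> nat) \<Rightarrow> nat"
  and weight_fm :: "('f, 'p, 'a, 'c) fm \<Rightarrow> (nat \<Rightarrow> nat) \<Rightarrow> nat"
where
  "weight_tm (Var i) = (\<lambda>\<rho>. \<rho> i)"
| "weight_tm (Fun f ts) = (\<lambda>\<rho>. \<Sum>w\<leftarrow>map weight_tm ts. w \<rho>)"
| "weight_tm (Eps A) = (\<lambda>\<rho>. weight_fm A (case_nat 0 \<rho>))"
| "weight_fm (FVar a ts) = (\<lambda>\<rho>. \<Sum>w\<leftarrow>map weight_tm ts. w \<rho>)"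
| "weight_fm (Pred p ts) = (\<lambda>\<rho>. \<Sum>w\<leftarrow>map weight_tm ts. w \<rho>)"
| "weight_fm (Neg A) = weight_fm A"
| "weight_fm (Or A B) = (\<lambda>\<rho>. weight_fm A \<rho> + weight_fm B \<rho>)"
| "weight_fm (And A B) = (\<lambda>\<rho>. weight_fm A \<rho> + weight_fm B \<rho>)"
| "weight_fm (Imp A B) = (\<lambda>\<rho>. weight_fm A \<rho> + weight_fm B \<rho>)"
| "weight_fm (Conn c As) = (\<lambda>\<rho>. \<Sum>w\<leftarrow>map weight_fm As. w \<rho>)"
| "weight_fm (Quant Q A) =
     (\<lambda>\<rho>. Suc (weight_fm A (case_nat (weight_fm A (case_nat 0 \<rho>)) \<rho>)))"

text \<open>Every clause is built from sums, successors and evaluation at a larger environment. The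
  lemma is for the quantifier clause, where the weight of the body is itself fed back as the value
  of the bound variable.\<close>

lemma weight_mono:
  fixes t :: "('f, 'p, 'a, 'c) tm" and A :: "('f, 'p, 'a, 'c) fm"
  shows "\<rho> \<le> \<sigma> \<Longrightarrow> weight_tm t \<rho> \<le> weight_tm t \<sigma>"
    and "\<rho> \<le> \<sigma> \<Longrightarrow> weight_fm A \<rho> \<le> weight_fm A \<sigma>"
proof (induction t and A arbitrary: \<rho> \<sigma> and \<rho> \<sigma>)
  case (Eps A)
  then show ?case by (simp add: le_fun_def split: nat.split)
next
  case (Quant Q A)
  \<comment> \<open>This compares the values given to the bound variable; the induction hypothesis
    is then used a second time, at the extended environments.\<close>
  have "weight_fm A (case_nat 0 \<rho>) \<le> weight_fm A (case_nat 0 \<sigma>)"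
    using Quant.prems by (intro Quant.IH) (simp add: le_fun_def split: nat.split)
  then show ?case
    using Quant.prems by (auto intro!: Quant.IH simp: le_fun_def split: nat.split)
qed (auto simp: le_fun_def add_mono intro!: sum_list_mono)

text \<open>Needed for substitution under a binder, where the substituted term is lifted.\<close>

lemma weight_lift:
  fixes t :: "('f, 'p, 'a, 'c) tm" and A :: "('f, 'p, 'a, 'c) fm"
  shows "weight_tm (lift_tm k t) \<rho> = weight_tm t (\<lambda>i. \<rho> (if i < k then i else Suc i))"
    and "weight_fm (lift_fm k A) \<rho> = weight_fm A (\<lambda>i. \<rho> (if i < k then i else Suc i))"
proof (induction t and A arbitrary: k \<rho> and k \<rho>)
  \<comment> \<open>Reindexing commutes with entering a binder. The value \<open>v\<close> stays
    arbitrary because \<open>Quant\<close> enters its body both with 0 and with the resulting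
    weight.\<close>
  have ext: "(\<lambda>i. case_nat v \<rho> (if i < Suc k then i else Suc i))
      = case_nat v (\<lambda>i. \<rho> (if i < k then i else Suc i))" for v k and \<rho> :: "nat \<Rightarrow> nat"
    by (auto simp: fun_eq_iff split: nat.split)
  {
    case (Eps A)
    then show ?case by (simp only: weight_tm.simps lift_tm.simps ext)
  next
    case (Quant Q A)
    then show ?case by (simp only: weight_fm.simps lift_fm.simps ext)
  }
qed (auto simp: o_def cong: map_cong)

lemma weight_subst:
  fixes t :: "('f, 'p, 'a, 'c) tm" and A :: "('f, 'p, 'a, 'c) fm"
  shows "weight_tm (subst_tm k s t) \<rho>
      = weight_tm t (\<lambda>i. if i < k then \<rho> i else if i = k then weight_tm s \<rho> else \<rho> (i - 1))"
    and "weight_fm (subst_fm k s A) \<rho>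
      = weight_fm A (\<lambda>i. if i < k then \<rho> i else if i = k then weight_tm s \<rho> else \<rho> (i - 1))"
proof (induction t and A arbitrary: k s \<rho> and k s \<rho>)
  \<comment> \<open>By \<open>weight_lift\<close> at 0, the lifted \<open>s\<close> ignores the new
    value \<open>v\<close> and keeps the weight it has in \<open>\<rho>\<close>.\<close>
  have ext: "(\<lambda>i. if i < Suc k then case_nat v \<rho> i
        else if i = Suc k then weight_tm (lift_tm 0 s) (case_nat v \<rho>) else case_nat v \<rho> (i - 1))
      = case_nat v (\<lambda>i. if i < k then \<rho> i else if i = k then weight_tm s \<rho> else \<rho> (i - 1))"
    for v k \<rho> and s :: "('f, 'p, 'a, 'c) tm"
    by (auto simp: fun_eq_iff weight_lift split: nat.split)
  {
    case (Eps A)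
    then show ?case by (simp only: weight_tm.simps subst_tm.simps ext)
  next
    case (Quant Q A)
    then show ?case by (simp only: weight_fm.simps subst_fm.simps ext)
  }
qed (auto simp: o_def cong: map_cong)

text \<open>Since negation weighs nothing, the epsilon-terms introduced for both quantifiers have
  the same weight, and one clause for \<open>Quant\<close> serves both.\<close>

lemma weight_neg_if_Forall [simp]: "weight_fm (neg_if_Forall Q A) = weight_fm A"
  by (cases Q) simp_all

lemma weight_subst_Eps:
  "Suc (weight_fm (subst_fm 0 (Eps (neg_if_Forall Q A)) A) \<rho>) = weight_fm (Quant Q A) \<rho>"
proof -
  have "(\<lambda>i. if i < 0 then \<rho> i else if i = 0 then v else \<rho> (i - 1)) = case_nat v \<rho>" for v
    by (auto simp: fun_eq_iff split: nat.split)
  then show ?thesis by (simp only: weight_subst weight_tm.simps weight_fm.simps weight_neg_if_Forall)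
qed

text \<open>The environment is universally quantified in the induction because passing under a
  binder changes it.\<close>

lemma weight_decreases:
  fixes t t' :: "('f, 'p, 'a, 'c) tm" and A A' :: "('f, 'p, 'a, 'c) fm"
  shows "qelim_tm t t' \<Longrightarrow> weight_tm t' \<rho> < weight_tm t \<rho>"
    and "A \<rightarrow>\<^sub>Q A' \<Longrightarrow> weight_fm A' \<rho> < weight_fm A \<rho>"
proof (induction arbitrary: \<rho> and \<rho> rule: qelim_tm_qelim.inducts)
  case (redex Q A)
  show ?case by (simp only: weight_subst_Eps [symmetric] lessI)
next
  case (Quant A A' Q)
  \<comment> \<open>The body occurs twice in the weight. Replacing the outer occurrence gives the
    strict decrease; the inner one only alters the environment, where \<open>weight_mono\<close>
    suffices.\<close>
  have "weight_fm A' (case_nat (weight_fm A' (case_nat 0 \<rho>)) \<rho>)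
      < weight_fm A (case_nat (weight_fm A' (case_nat 0 \<rho>)) \<rho>)"
    by (rule Quant.IH)
  also have "\<dots> \<le> weight_fm A (case_nat (weight_fm A (case_nat 0 \<rho>)) \<rho>)"
    using Quant.IH by (intro weight_mono) (auto simp: le_fun_def less_imp_le split: nat.split)
  finally show ?case by simp
qed simp_all

theorem theorem3p7:
  fixes S :: "('f, 'p, 'a, 'c) signature"
  shows "wfp_on (formulas S) qelim\<inverse>\<inverse>
    \<and> (\<forall>B \<subseteq> formulas S. B \<noteq> {} \<longrightarrow> (\<exists>a \<in> B. \<not> (\<exists>a' \<in> B. a \<rightarrow>\<^sub>Q a')))
    \<and> \<not> (\<exists>F :: nat \<Rightarrow> ('f, 'p, 'a, 'c) fm.
          (\<forall>i. F i \<in> formulas S) \<and> (\<forall>i. F i \<rightarrow>\<^sub>Q F (Suc i)))"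
proof -
  \<comment> \<open>The decrease holds in every environment, so the constant 0 is an arbitrary
    choice. Well-foundedness is obtained on the whole type and restricted to
    \<open>formulas S\<close> at the end.\<close>
  have wf: "wfp (qelim\<inverse>\<inverse> :: ('f, 'p, 'a, 'c) fm \<Rightarrow> _)"
    by (rule wfp_if_convertible_to_nat[where f = "\<lambda>A. weight_fm A (\<lambda>_. 0)"])
      (simp add: weight_decreases)
  have "\<exists>a \<in> B. \<not> (\<exists>a' \<in> B. a \<rightarrow>\<^sub>Q a')" if "B \<noteq> {}" for B :: "('f, 'p, 'a, 'c) fm set"
    using that wf[unfolded wfp_iff_ex_minimal, rule_format, of B] by auto
  moreover have "\<not> (\<forall>i. F i \<rightarrow>\<^sub>Q F (Suc i))" for F :: "nat \<Rightarrow> ('f, 'p, 'a, 'c) fm"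
    using wf by (auto simp: wfp_def wf_iff_no_infinite_down_chain)
  ultimately show ?thesis
    using wfp_on_subset[OF wf, of "formulas S"] by blast
qed

end
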